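(* For all $f,g\in\mathcal O_K$, $$|f\pm g|_\theta\le \theta^2\max\{|f|_\theta,|g|_\theta\}.$$
   Context: $\theta>1$ is a real quadratic unit with $N(\theta)=-1$, so $\theta^2=a\theta+1$ with an integer $a\ge1$; $K=\mathbb Q(\theta)\subset\mathbb R$, $\mathcal O_K$ its ring of integers. A greedy polynomial is a finite sum $\sum_{i=m}^M b_i\theta^i$ with $b_i\in\{0,\dots,a\}$ such that $b_i=a$ implies $b_{i-1}=0$. Every nonzero $\alpha\in\mathcal O_K$ can be written uniquely as $\alpha=\pm\sum_{i=m}^M b_i\theta^i$ with the sum a greedy polynomial and $b_m\ne0$ (its greedy $\theta$-expansion). The $\theta$-adic infranorm is $|\alpha|_\theta:=\theta^{-m}$ for such $\alpha$, and $|0|_\theta:=0$.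
   Formalization: The formal theorem takes f, g in Z[θ], exactly where the infranorm is defined; for θ=2+√5 the element (1+√5)/2 of O_K has no greedy expansion, so the claim for all of O_K is meaningful only when O_K = Z[θ]. *)

theory Defs
  imports Complex_Main "HOL-Computational_Algebra.Polynomial"
begin

definition is_subring :: "real set \<Rightarrow> bool" where
  "is_subring S \<longleftrightarrow> 1 \<in> S \<and> (\<forall>x\<in>S. \<forall>y\<in>S. x - y \<in> S \<and> x * y \<in> S)"

definition is_subfield :: "real set \<Rightarrow> bool" where
  "is_subfield S \<longleftrightarrow> is_subring S \<and> (\<forall>x\<in>S. inverse x \<in> S)"

definition Q_adjoin :: "real \<Rightarrow> real set" where
  "Q_adjoin \<theta> = is_subfield hull {\<theta>}"

definition Z_adjoin :: "real \<Rightarrow> real set" where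
  "Z_adjoin \<theta> = is_subring hull {\<theta>}"

definition ring_of_integers :: "real set \<Rightarrow> real set" where
  "ring_of_integers K = {x \<in> K. algebraic_int x}"

text \<open>
  A greedy polynomial is encoded by its digit function on all integer indices, extended by 0
  outside the finite range of summation. For \<open>a \<ge> 1\<close> the last condition at the lowest index is
  then vacuous, as the digit below it is 0.
\<close>

definition greedy_digits :: "int \<Rightarrow> (int \<Rightarrow> int) \<Rightarrow> bool" where
  "greedy_digits a b \<longleftrightarrow>
     finite {i. b i \<noteq> 0} \<and> (\<forall>i. 0 \<le> b i \<and> b i \<le> a) \<and> (\<forall>i. b i = a \<longrightarrow> b (i - 1) = 0)"

definition digits_value :: "real \<Rightarrow> (int \<Rightarrow> int) \<Rightarrow> real" where
  "digits_value \<theta> b = (\<Sum>i | b i \<noteq> 0. of_int (b i) * \<theta> powi i)"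

definition greedy_expansion :: "int \<Rightarrow> real \<Rightarrow> real \<Rightarrow> int \<Rightarrow> (int \<Rightarrow> int) \<Rightarrow> bool" where
  "greedy_expansion a \<theta> \<alpha> m b \<longleftrightarrow>
     greedy_digits a b \<and> b m \<noteq> 0 \<and> (\<forall>i<m. b i = 0) \<and>
     (\<alpha> = digits_value \<theta> b \<or> \<alpha> = - digits_value \<theta> b)"

text \<open>
  The value is meaningful for \<open>\<alpha> = 0\<close> and for those \<open>\<alpha>\<close> that have a greedy expansion. All of these
  lie in \<open>Z_adjoin \<theta>\<close>, because \<open>inverse \<theta> = \<theta> - a\<close> when \<open>\<theta>\<^sup>2 = a * \<theta> + 1\<close>. Elsewhere it is unspecified.
\<close>

definition infranorm :: "int \<Rightarrow> real \<Rightarrow> real \<Rightarrow> real" where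
  "infranorm a \<theta> \<alpha> =
     (if \<alpha> = 0 then 0 else \<theta> powi (- (THE m. \<exists>b. greedy_expansion a \<theta> \<alpha> m b)))"

end

theory Submission
  imports Defs
begin

text \<open>
  Let \<open>\<omega> = a - \<theta> = -1/\<theta>\<close> be the conjugate of \<open>\<theta>\<close>. A nonnegative element of \<open>\<int>[\<theta>]\<close> is a greedy
  polynomial without negative powers if and only if its conjugate lies in \<open>(-1, \<theta>)\<close>. The lowest
  digit is read off from the subdivision of \<open>(-1, \<theta>)\<close> at the points \<open>\<theta> - a, \<theta> - a + 1, \<dots>, \<theta> - 1\<close>;
  removing it and dividing by \<open>\<theta>\<close> preserves the condition, and this process stops because no element
  of \<open>(0, 1)\<close> satisfies it. Hence \<open>\<bar>\<alpha>\<bar>\<^sub>\<theta> \<le> \<theta>\<^sup>-\<^sup>n\<close> holds for \<open>\<alpha> > 0\<close> if and only if the conjugate of \<open>\<alpha>\<close>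
  multiplied by \<open>(-\<theta>)\<^sup>n\<close> lies in \<open>(-1, \<theta>)\<close>, and the inequality reduces to the fact that sums and
  differences of two elements of this interval lie in \<open>\<theta>\<^sup>2 (-1, \<theta>)\<close>.
\<close>

locale quadratic_unit =
  fixes \<theta> :: real and a :: int
  assumes theta_gt_1: "\<theta> > 1" and a_ge_1: "a \<ge> 1" and theta_eq: "\<theta>\<^sup>2 = of_int a * \<theta> + 1"
begin

section \<open>The conjugate unit and the irrationality of \<theta>\<close>

definition \<omega> :: real where "\<omega> = of_int a - \<theta>"

lemma omega_eq: "\<omega>\<^sup>2 = of_int a * \<omega> + 1"
  using theta_eq by (simp add: \<omega>_def power2_eq_square algebra_simps)

lemma theta_omega: "\<theta> * \<omega> = -1"
  using theta_eq by (simp add: \<omega>_def power2_eq_square algebra_simps)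

lemma omega_bounds: "-1 < \<omega>" "\<omega> < 0"
proof -
  show "\<omega> < 0"
  proof (rule ccontr)
    assume "\<not> \<omega> < 0"
    then have "0 \<le> \<theta> * \<omega>" using theta_gt_1 by simp
    then show False using theta_omega by simp
  qed
  show "-1 < \<omega>"
  proof (rule ccontr)
    assume "\<not> -1 < \<omega>"
    then have "\<theta> * \<omega> \<le> \<theta> * (-1)"
      using theta_gt_1 by (intro mult_left_mono) auto
    then show False
      using theta_omega theta_gt_1 by simp
  qed
qed

text \<open>A rational algebraic integer is an integer, but then \<open>\<omega>\<close>, which is
  \<open>a - \<theta>\<close>, would be an integer strictly between -1 and 0.\<close>

lemma theta_not_rat: "\<theta> \<notin> \<rat>"
proof
  assume "\<theta> \<in> \<rat>"
  moreover have "algebraic_int \<theta>"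
  proof (rule algebraic_int.intros)
    show "lead_coeff [:-1, - of_int a, 1:] = (1::real)" by simp
    show "\<forall>i. coeff [:-1, - of_int a, 1:] i \<in> (\<int>::real set)"
      by (auto simp: coeff_pCons split: nat.splits)
    show "poly [:-1, - of_int a, 1:] \<theta> = 0"
      using theta_eq by (simp add: algebra_simps power2_eq_square)
  qed
  ultimately have "\<theta> \<in> \<int>"
    using rational_algebraic_int_is_int by blast
  then obtain k where "\<theta> = of_int k"
    by (auto elim: Ints_cases)
  then have "of_int (-1) < (of_int (a - k) :: real)" "of_int (a - k) < (of_int 0 :: real)"
    using omega_bounds unfolding \<omega>_def by simp_all
  then show False
    unfolding of_int_less_iff by linarith
qed

lemma int_linear_combination_eq_0:
  assumes "of_int x + of_int y * \<theta> = 0"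
  shows "x = 0 \<and> y = 0"
proof -
  have "y = 0"
  proof (rule ccontr)
    assume "y \<noteq> 0"
    with assms have "\<theta> = - of_int x / of_int y"
      by (simp add: field_simps)
    then have "\<theta> \<in> \<rat>" by simp
    then show False using theta_not_rat by simp
  qed
  with assms show ?thesis by simp
qed

section \<open>Conjugation on \<int>[\<theta>], as a relation\<close>

definition conjugates :: "real \<Rightarrow> real \<Rightarrow> bool" where
  "conjugates \<alpha> \<beta> \<longleftrightarrow>
     (\<exists>x y. \<alpha> = of_int x + of_int y * \<theta> \<and> \<beta> = of_int x + of_int y * \<omega>)"

lemma conjugates_of_int: "conjugates (of_int x) (of_int x)"
  unfolding conjugates_def by (rule exI[of _ x], rule exI[of _ 0]) simp

lemma conjugates_theta: "conjugates \<theta> \<omega>"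
  unfolding conjugates_def by (rule exI[of _ 0], rule exI[of _ 1]) simp

lemma conjugates_add:
  assumes "conjugates \<alpha> \<beta>" "conjugates \<alpha>' \<beta>'"
  shows "conjugates (\<alpha> + \<alpha>') (\<beta> + \<beta>')"
proof -
  from assms obtain x y u v where
    "\<alpha> = of_int x + of_int y * \<theta>" "\<beta> = of_int x + of_int y * \<omega>"
    "\<alpha>' = of_int u + of_int v * \<theta>" "\<beta>' = of_int u + of_int v * \<omega>"
    unfolding conjugates_def by auto
  then show ?thesis
    unfolding conjugates_def by (intro exI[of _ "x + u"] exI[of _ "y + v"]) (simp add: algebra_simps)
qed

lemma conjugates_mult:
  assumes "conjugates \<alpha> \<beta>" "conjugates \<alpha>' \<beta>'"
  shows "conjugates (\<alpha> * \<alpha>') (\<beta> * \<beta>')"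
proof -
  from assms obtain x y u v where *:
    "\<alpha> = of_int x + of_int y * \<theta>" "\<beta> = of_int x + of_int y * \<omega>"
    "\<alpha>' = of_int u + of_int v * \<theta>" "\<beta>' = of_int u + of_int v * \<omega>"
    unfolding conjugates_def by auto
  \<comment> \<open>The product is reduced by the quadratic equation alone, so the same two
    coordinates serve for \<theta> and for \<open>\<omega>\<close>.\<close>
  have "(of_int x + of_int y * z) * (of_int u + of_int v * z) =
      of_int (x * u + y * v) + of_int (x * v + y * u + a * y * v) * z"
    if "z\<^sup>2 = of_int a * z + 1" for z :: real
  proof -
    have "(of_int x + of_int y * z) * (of_int u + of_int v * z) =
        of_int x * of_int u + (of_int x * of_int v + of_int y * of_int u) * z + of_int y * of_int v * z\<^sup>2"
      by (simp add: algebra_simps power2_eq_square)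
    then show ?thesis
      unfolding that by (simp add: algebra_simps)
  qed
  from this[OF theta_eq] this[OF omega_eq] show ?thesis
    unfolding conjugates_def * by blast
qed

lemma conjugates_minus:
  assumes "conjugates \<alpha> \<beta>"
  shows "conjugates (- \<alpha>) (- \<beta>)"
  using conjugates_mult[OF conjugates_of_int[of "-1"] assms] by simp

lemma conjugates_diff:
  assumes "conjugates \<alpha> \<beta>" "conjugates \<alpha>' \<beta>'"
  shows "conjugates (\<alpha> - \<alpha>') (\<beta> - \<beta>')"
  using conjugates_add[OF assms(1) conjugates_minus[OF assms(2)]] by simp

lemma conjugates_power:
  assumes "conjugates \<alpha> \<beta>"
  shows "conjugates (\<alpha> ^ n) (\<beta> ^ n)"
proof (induction n)
  case 0
  show ?case using conjugates_of_int[of 1] by simp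
next
  case (Suc n)
  then show ?case using conjugates_mult[OF assms] by simp
qed

lemma inverse_theta: "inverse \<theta> = - \<omega>"
  using theta_omega theta_gt_1 by (simp add: field_simps)

lemma inverse_omega: "inverse \<omega> = - \<theta>"
  using theta_omega omega_bounds by (simp add: field_simps)

text \<open>The two sides are the inverses of \<theta> and \<open>\<omega>\<close>; this extends
  conjugation to negative powers.\<close>

lemma conjugates_inverse_theta: "conjugates (- \<omega>) (- \<theta>)"
  unfolding conjugates_def \<omega>_def by (rule exI[of _ "-a"], rule exI[of _ 1]) simp

lemma conjugates_powi: "conjugates (\<theta> powi n) (\<omega> powi n)"
  using conjugates_power[OF conjugates_theta] conjugates_power[OF conjugates_inverse_theta]
  by (simp add: power_int_def inverse_theta inverse_omega)

lemma conjugates_sum: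
  assumes "\<And>i. i \<in> A \<Longrightarrow> conjugates (f i) (g i)"
  shows "conjugates (sum f A) (sum g A)"
  using assms
proof (induction A rule: infinite_finite_induct)
  case (insert x F)
  then show ?case by (simp add: conjugates_add)
qed (use conjugates_of_int[of 0] in auto)

text \<open>The difference of the two conjugates is a conjugate of 0, whose coordinates vanish
  because \<theta> is irrational. Hence a conjugate computed from digits can be identified with a
  given one.\<close>

lemma conjugates_unique:
  assumes "conjugates \<alpha> \<beta>" "conjugates \<alpha> \<beta>'"
  shows "\<beta> = \<beta>'"
proof -
  from conjugates_diff[OF assms] obtain x y where
    *: "0 = of_int x + of_int y * \<theta>" "\<beta> - \<beta>' = of_int x + of_int y * \<omega>"
    unfolding conjugates_def by auto
  then show ?thesis
    using int_linear_combination_eq_0[of x y] by simp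
qed

lemma conjugates_sym:
  assumes "conjugates \<alpha> \<beta>"
  shows "conjugates \<beta> \<alpha>"
proof -
  from assms obtain x y where
    *: "\<alpha> = of_int x + of_int y * \<theta>" "\<beta> = of_int x + of_int y * \<omega>"
    unfolding conjugates_def by auto
  then show ?thesis
    unfolding conjugates_def \<omega>_def
    by (intro exI[of _ "x + y * a"] exI[of _ "-y"]) (simp add: algebra_simps)
qed

lemma Z_adjoin_conjugates:
  assumes "\<alpha> \<in> Z_adjoin \<theta>"
  obtains \<beta> where "conjugates \<alpha> \<beta>"
proof -
  have "is_subring {\<alpha>. \<exists>\<beta>. conjugates \<alpha> \<beta>}"
    unfolding is_subring_def
  proof (intro conjI ballI)
    show "1 \<in> {\<alpha>. \<exists>\<beta>. conjugates \<alpha> \<beta>}"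
      using conjugates_of_int[of 1] by auto
  qed (use conjugates_diff conjugates_mult in blast)+
  then have "Z_adjoin \<theta> \<subseteq> {\<alpha>. \<exists>\<beta>. conjugates \<alpha> \<beta>}"
    unfolding Z_adjoin_def using conjugates_theta by (intro hull_minimal) auto
  with assms that show thesis by auto
qed

section \<open>Conjugates of greedy polynomials without negative powers\<close>

definition nat_digits :: "(nat \<Rightarrow> int) \<Rightarrow> nat \<Rightarrow> bool" where
  "nat_digits c N \<longleftrightarrow> (\<forall>k. 0 \<le> c k \<and> c k \<le> a) \<and> (\<forall>k. c (Suc k) = a \<longrightarrow> c k = 0) \<and>
     (\<forall>k\<ge>N. c k = 0)"

text \<open>The base is a parameter because the same digits are evaluated at \<theta> and at
  \<open>\<omega>\<close>. \<open>N\<close> is only an upper bound for the number of digits: leading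
  zeros are allowed.\<close>

definition nat_value :: "real \<Rightarrow> (nat \<Rightarrow> int) \<Rightarrow> nat \<Rightarrow> real" where
  "nat_value z c N = (\<Sum>k<N. of_int (c k) * z ^ k)"

lemma nat_value_Suc: "nat_value z c (Suc N) = of_int (c 0) + z * nat_value z (\<lambda>k. c (Suc k)) N"
  unfolding nat_value_def sum.lessThan_Suc_shift by (simp add: sum_distrib_left mult_ac)

lemma conjugates_nat_value: "conjugates (nat_value \<theta> c N) (nat_value \<omega> c N)"
  unfolding nat_value_def
  by (intro conjugates_sum conjugates_mult conjugates_of_int conjugates_power conjugates_theta)

text \<open>The value is \<open>c 0 + \<omega> * V\<close>, where \<open>V\<close> belongs to the
  shifted digits and lies in (-1, \<theta>); multiplication by \<open>\<omega>\<close> reverses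
  order and yields (-1, -\<open>\<omega>\<close>). If \<open>c 0 \<ge> 1\<close>, the greedy
  condition forces \<open>c 1 \<le> a - 1\<close>, hence \<open>V < \<theta> - 1\<close>, which
  raises the lower end to \<open>-1 - \<omega>\<close>. The resulting intervals for different
  \<open>c 0\<close> are disjoint.\<close>

lemma nat_value_omega_bounds:
  assumes "nat_digits c N"
  shows "-1 < nat_value \<omega> c N" and "nat_value \<omega> c N < of_int (c 0) - \<omega>"
    and "c 0 \<ge> 1 \<Longrightarrow> of_int (c 0) - 1 - \<omega> < nat_value \<omega> c N"
proof -
  have "-1 < nat_value \<omega> c N \<and> nat_value \<omega> c N < of_int (c 0) - \<omega> \<and>
      (c 0 \<ge> 1 \<longrightarrow> of_int (c 0) - 1 - \<omega> < nat_value \<omega> c N)"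
    using assms
  proof (induction N arbitrary: c)
    case 0
    then show ?case
      using omega_bounds by (simp add: nat_digits_def nat_value_def)
  next
    case (Suc N)
    define V where "V = nat_value \<omega> (\<lambda>k. c (Suc k)) N"
    have V: "-1 < V" "V < of_int (c 1) - \<omega>"
      using Suc.IH[of "\<lambda>k. c (Suc k)"] Suc.prems unfolding nat_digits_def V_def by auto
    have c0: "0 \<le> c 0" and c1: "c 1 \<le> a" and c1_eq: "c 1 = a \<Longrightarrow> c 0 = 0"
      using Suc.prems unfolding nat_digits_def One_nat_def by blast+
    have c01: "c 1 \<le> a - 1" if "c 0 \<ge> 1"
      using c1 c1_eq that by linarith
    have mono: "\<omega> * s < \<omega> * r" if "r < s" for r s
      using that omega_bounds(2) by (rule mult_strict_left_mono_neg)
    have "real_of_int (c 1) \<le> of_int a" using c1 by simp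
    then have "V < \<theta>" using V(2) by (simp add: \<omega>_def)
    then have 1: "\<omega> * \<theta> < \<omega> * V" by (rule mono)
    have 2: "\<omega> * V < \<omega> * (-1)" using V(1) by (rule mono)
    have 3: "\<omega> * (\<theta> - 1) < \<omega> * V" if "c 0 \<ge> 1"
    proof (rule mono)
      have "real_of_int (c 1) \<le> of_int (a - 1)"
        using c01[OF that] by (simp only: of_int_le_iff)
      then show "V < \<theta> - 1" using V(2) by (simp add: \<omega>_def)
    qed
    have "real_of_int (c 0) \<ge> 0" using c0 by simp
    moreover have "nat_value \<omega> c (Suc N) = of_int (c 0) + \<omega> * V"
      unfolding nat_value_Suc V_def ..
    moreover have "\<omega> * (\<theta> - 1) = -1 - \<omega>" "\<omega> * \<theta> = -1"
      using theta_omega by (simp_all add: algebra_simps)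
    ultimately show ?case
      using 1 2 3 by simp
  qed
  then show "-1 < nat_value \<omega> c N" "nat_value \<omega> c N < of_int (c 0) - \<omega>"
    "c 0 \<ge> 1 \<Longrightarrow> of_int (c 0) - 1 - \<omega> < nat_value \<omega> c N" by auto
qed

section \<open>Existence of expansions without negative powers\<close>

lemma conjugates_cases:
  assumes "conjugates \<alpha> \<beta>"
  obtains x where "\<alpha> = of_int x" "\<beta> = of_int x"
  | "\<alpha> - \<beta> \<ge> \<theta> - \<omega>"
  | "\<alpha> - \<beta> \<le> \<omega> - \<theta>"
proof -
  from assms obtain x y where
    *: "\<alpha> = of_int x + of_int y * \<theta>" "\<beta> = of_int x + of_int y * \<omega>"
    unfolding conjugates_def by auto
  then have d: "\<alpha> - \<beta> = of_int y * (\<theta> - \<omega>)" by (simp add: algebra_simps)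
  have pos: "\<theta> - \<omega> > 0" using theta_gt_1 omega_bounds by simp
  consider "y = 0" | "y \<ge> 1" | "y \<le> -1" by linarith
  then show thesis
  proof cases
    case 1
    then show ?thesis using * that(1) by simp
  next
    case 2
    then have "1 * (\<theta> - \<omega>) \<le> of_int y * (\<theta> - \<omega>)"
      using pos by (intro mult_right_mono) auto
    then show ?thesis using d that(2) by simp
  next
    case 3
    then have "real_of_int y \<le> of_int (-1)" by (simp only: of_int_le_iff)
    then have "of_int y * (\<theta> - \<omega>) \<le> (-1) * (\<theta> - \<omega>)"
      using pos by (intro mult_right_mono) auto
    then show ?thesis using d that(3) by simp
  qed
qed

lemma theta_minus_omega_gt_2: "\<theta> - \<omega> > 2"
proof -
  \<comment> \<open>The product equals \<open>\<theta> - \<omega> - 2\<close>, since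
    \<open>\<theta> * \<omega> = -1\<close>.\<close>
  have "(\<theta> - 1) * (1 + \<omega>) > 0"
    using theta_gt_1 omega_bounds by simp
  then show ?thesis using theta_omega by (simp add: algebra_simps)
qed

text \<open>The digit is the index of the subinterval of (-1, \<theta>) that contains \<beta>. That
  it does not exceed \<alpha> follows from \<open>conjugates_cases\<close> for
  \<open>\<alpha> - of_int k\<close>: the difference of an element and its conjugate cannot be small
  without being 0.\<close>

lemma lowest_digit:
  assumes conj: "conjugates \<alpha> \<beta>" and \<alpha>: "0 \<le> \<alpha>" and \<beta>: "-1 < \<beta>" "\<beta> < \<theta>"
  obtains k where "0 \<le> k" "k \<le> a" "of_int k \<le> \<alpha>" "of_int k - 1 < \<beta>" "\<beta> < of_int k - \<omega>"
    "k \<ge> 1 \<Longrightarrow> of_int k - 1 - \<omega> < \<beta>"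
proof -
  \<comment> \<open>The interval of digit 0 is longer than 1, so the ceiling can also be -1
    there.\<close>
  define k where "k = max 0 \<lceil>\<beta> + \<omega>\<rceil>"
  have k0: "0 \<le> k" by (simp add: k_def)
  have ka: "k \<le> a"
    using \<beta> a_ge_1 by (simp add: k_def \<omega>_def ceiling_le_iff)
  have le: "\<beta> \<le> of_int k - \<omega>"
    using le_of_int_ceiling[of "\<beta> + \<omega>"] unfolding k_def
    by (smt (verit) of_int_le_iff)
  have gt: "of_int k - 1 - \<omega> < \<beta>" if "k \<ge> 1"
    using that ceiling_correct[of "\<beta> + \<omega>"] unfolding k_def by (simp add: max_def split: if_splits)
  have gt': "of_int k - 1 < \<beta>"
    using gt \<beta>(1) k0 omega_bounds by (cases "k \<ge> 1") auto
  \<comment> \<open>At a division point, \<alpha> would be \<open>k - \<theta>\<close>, which is at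
    most \<open>\<omega>\<close> and so negative.\<close>
  have ne: "\<beta> \<noteq> of_int k - \<omega>"
  proof
    assume "\<beta> = of_int k - \<omega>"
    then have "conjugates \<beta> (of_int k - \<theta>)"
      using conjugates_diff[OF conjugates_of_int conjugates_sym[OF conjugates_theta]] by simp
    then have "\<alpha> = of_int k - \<theta>"
      using conjugates_unique conjugates_sym[OF conj] by blast
    moreover have "real_of_int k \<le> of_int a" using ka by simp
    ultimately show False using \<alpha> omega_bounds by (simp add: \<omega>_def)
  qed
  have "of_int k \<le> \<alpha>"
  proof (cases "k \<ge> 1")
    case False
    then show ?thesis using \<alpha> k0 by simp
  next
    case True
    have "conjugates (\<alpha> - of_int k) (\<beta> - of_int k)"
      by (intro conjugates_diff conj conjugates_of_int)
    then show ?thesis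
    proof (cases rule: conjugates_cases)
      case (1 x)
      then have "real_of_int x > of_int (-1)"
        using gt' by simp
      then have "x \<ge> 0" unfolding of_int_less_iff by simp
      then show ?thesis using 1 by (simp add: algebra_simps)
    next
      case 2
      then show ?thesis using gt[OF True] theta_gt_1 omega_bounds by simp
    next
      case 3
      have "real_of_int k \<le> of_int a" using ka by simp
      then show ?thesis using 3 \<alpha> le ne omega_bounds by (simp add: \<omega>_def)
    qed
  qed
  then show thesis
    using that k0 ka gt' gt le ne by force
qed

text \<open>Each step splits off the lowest digit and divides by \<theta>, which lowers the exponent
  in the bound on \<alpha>. In the base case \<alpha> lies in [0, 1): either it is an integer, hence
  0, or \<open>\<alpha> - \<beta>\<close> is too close to 0 for a nonzero multiple of
  \<open>\<theta> - \<omega>\<close>.\<close>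

lemma nat_digits_exist:
  assumes "conjugates \<alpha> \<beta>" "0 \<le> \<alpha>" "\<alpha> < \<theta> ^ N" "-1 < \<beta>" "\<beta> < \<theta>"
  shows "\<exists>c. nat_digits c N \<and> \<alpha> = nat_value \<theta> c N"
  using assms
proof (induction N arbitrary: \<alpha> \<beta>)
  case 0
  have "\<alpha> = 0"
    using 0(1)
  proof (cases rule: conjugates_cases)
    case (1 x)
    then show ?thesis using 0 by simp
  next
    case 2
    then show ?thesis using 0 theta_minus_omega_gt_2 by simp
  next
    case 3
    then show ?thesis using 0 omega_bounds by simp
  qed
  then show ?case
    using a_ge_1 by (intro exI[of _ "\<lambda>_. 0"]) (simp add: nat_digits_def nat_value_def)
next
  case (Suc N)
  from lowest_digit[OF Suc.prems(1,2,4,5)] obtain k where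
    k: "0 \<le> k" "k \<le> a" "of_int k \<le> \<alpha>" "of_int k - 1 < \<beta>" "\<beta> < of_int k - \<omega>"
    "k \<ge> 1 \<Longrightarrow> of_int k - 1 - \<omega> < \<beta>" by blast
  \<comment> \<open>The factors \<open>- \<omega>\<close> and \<open>- \<theta>\<close> are division
    by \<theta> and by its conjugate.\<close>
  define \<alpha>1 where "\<alpha>1 = (\<alpha> - of_int k) * (- \<omega>)"
  define \<beta>1 where "\<beta>1 = (\<beta> - of_int k) * (- \<theta>)"
  have conj1: "conjugates \<alpha>1 \<beta>1"
    unfolding \<alpha>1_def \<beta>1_def
    by (intro conjugates_mult conjugates_diff Suc.prems conjugates_of_int conjugates_inverse_theta)
  have \<alpha>_eq: "\<alpha> = of_int k + \<theta> * \<alpha>1"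
  proof -
    have "\<theta> * \<alpha>1 = - (\<theta> * \<omega>) * (\<alpha> - of_int k)"
      by (simp add: \<alpha>1_def algebra_simps)
    then show ?thesis using theta_omega by simp
  qed
  have mono: "r * (- \<theta>) < s * (- \<theta>)" if "s < r" for r s
    using that theta_gt_1 by simp
  have "(- \<omega>) * (- \<theta>) < \<beta>1"
    unfolding \<beta>1_def using k by (intro mono) simp
  then have \<beta>1_gt: "-1 < \<beta>1" using theta_omega by (simp add: mult.commute)
  have "\<beta>1 < (-1) * (- \<theta>)"
    unfolding \<beta>1_def using k by (intro mono) simp
  then have \<beta>1_less: "\<beta>1 < \<theta>" by simp
  have \<beta>1_less': "\<beta>1 < \<theta> - 1" if "k \<ge> 1"
  proof -
    have "\<beta>1 < (-1 - \<omega>) * (- \<theta>)"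
      unfolding \<beta>1_def using k(6)[OF that] by (intro mono) simp
    then show ?thesis using theta_omega by (simp add: algebra_simps)
  qed
  have "\<alpha>1 \<ge> 0"
    unfolding \<alpha>1_def using k omega_bounds by (simp add: mult_le_0_iff)
  moreover have "\<alpha>1 < \<theta> ^ N"
  proof -
    have "real_of_int k \<ge> 0" using k by simp
    then have "\<theta> * \<alpha>1 < \<theta> * \<theta> ^ N"
      using \<alpha>_eq Suc.prems by simp
    then show ?thesis using theta_gt_1 by simp
  qed
  ultimately obtain c where c: "nat_digits c N" "\<alpha>1 = nat_value \<theta> c N"
    using Suc.IH[OF conj1 _ _ \<beta>1_gt \<beta>1_less] by auto
  have \<beta>1_eq: "\<beta>1 = nat_value \<omega> c N"
    using conj1 conjugates_nat_value c(2) conjugates_unique by blast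
  \<comment> \<open>A next digit \<open>a\<close> puts \<open>\<beta>1\<close> above
    \<open>a - 1 - \<omega>\<close>, which is \<open>\<theta> - 1\<close>; a nonzero
    \<open>k\<close> puts it below.\<close>
  have "c 0 = a \<Longrightarrow> k = 0"
  proof (rule ccontr)
    assume *: "c 0 = a" "k \<noteq> 0"
    then have "of_int a - 1 - \<omega> < \<beta>1"
      using nat_value_omega_bounds(3)[OF c(1)] a_ge_1 \<beta>1_eq by simp
    then show False using \<beta>1_less' * k(1) by (simp add: \<omega>_def)
  qed
  then have "nat_digits (case_nat k c) (Suc N)"
    using c(1) k unfolding nat_digits_def by (auto split: nat.splits)
  moreover have "\<alpha> = nat_value \<theta> (case_nat k c) (Suc N)"
    unfolding nat_value_Suc using \<alpha>_eq c(2) by simp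
  ultimately show ?case by blast
qed

section \<open>Expansions with negative powers and their lowest index\<close>

lemma digits_value_eq_nat_value:
  assumes "\<And>i. b i \<noteq> 0 \<Longrightarrow> m \<le> i \<and> i < m + int N"
  shows "digits_value \<theta> b = \<theta> powi m * nat_value \<theta> (\<lambda>k. b (m + int k)) N"
proof -
  have img: "(\<lambda>k. m + int k) ` {..<N} = {m..<m + int N}"
  proof (intro equalityI subsetI)
    fix i assume "i \<in> {m..<m + int N}"
    then show "i \<in> (\<lambda>k. m + int k) ` {..<N}"
      by (intro image_eqI[of _ _ "nat (i - m)"]) auto
  qed auto
  have "digits_value \<theta> b = (\<Sum>i\<in>{m..<m + int N}. of_int (b i) * \<theta> powi i)"
    unfolding digits_value_def using assms by (intro sum.mono_neutral_left) auto
  also have "\<dots> = (\<Sum>k<N. of_int (b (m + int k)) * \<theta> powi (m + int k))"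
    unfolding img[symmetric] by (subst sum.reindex) (auto simp: inj_on_def)
  also have "\<dots> = \<theta> powi m * nat_value \<theta> (\<lambda>k. b (m + int k)) N"
    unfolding nat_value_def sum_distrib_left using theta_gt_1
    by (intro sum.cong refl) (simp add: power_int_add)
  finally show ?thesis .
qed

text \<open>Since \<open>(- \<theta>) powi n\<close> is the conjugate of
  \<open>\<theta> powi (- n)\<close>, this tests whether an element with conjugate \<beta>, shifted
  down by \<open>n\<close> places, has its conjugate in (-1, \<theta>).\<close>

definition in_window :: "int \<Rightarrow> real \<Rightarrow> bool" where
  "in_window n \<beta> \<longleftrightarrow> -1 < (- \<theta>) powi n * \<beta> \<and> (- \<theta>) powi n * \<beta> < \<theta>"

text \<open>Division by -\<theta> maps (-1, \<theta>) into (-1, 1/\<theta>), which is contained in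
  (-1, \<theta>).\<close>

lemma in_window_antimono:
  assumes "in_window n \<beta>" "m \<le> n"
  shows "in_window m \<beta>"
  using assms(2,1)
proof (induction m rule: int_le_induct)
  case (step i)
  define r where "r = (- \<theta>) powi (i - 1) * \<beta>"
  have "(- \<theta>) powi i = (- \<theta>) powi (i - 1) * (- \<theta>)"
    using power_int_minus_mult[of "- \<theta>" i] theta_gt_1 by simp
  then have "(- \<theta>) powi i * \<beta> = - \<theta> * r" by (simp add: r_def)
  with step have *: "-1 < - \<theta> * r" "- \<theta> * r < \<theta>"
    unfolding in_window_def by auto
  have "\<theta> * (-1) < \<theta> * r" using *(2) by simp
  then have "-1 < r" using theta_gt_1 by (simp only: mult_less_cancel_left_pos)
  moreover have "r < \<theta>"
  proof (rule ccontr)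
    assume "\<not> r < \<theta>"
    then have "1 * 1 \<le> \<theta> * r" using theta_gt_1 by (intro mult_mono) auto
    then show False using * theta_gt_1 by simp
  qed
  ultimately show ?case unfolding in_window_def r_def by simp
qed

lemma omega_powi_theta_powi: "(- \<theta>) powi n * \<omega> powi n = 1"
  using theta_omega by (simp flip: power_int_mult_distrib)

text \<open>A nonzero lowest digit puts the conjugate scaled for \<open>m\<close> into
  (-\<open>\<omega>\<close>, \<theta>), inside the window; one more factor -\<theta> sends it below
  -1. Monotonicity settles all other \<open>n\<close>. Thus the conjugate alone determines
  \<open>m\<close>, whence its uniqueness. The factor \<open>sgn \<alpha>\<close> passes to the
  conjugate of the positive element \<open>digits_value \<theta> b\<close>.\<close>

lemma greedy_expansion_in_window:
  assumes conj: "conjugates \<alpha> \<beta>" and exp: "greedy_expansion a \<theta> \<alpha> m b"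
  shows "in_window n (sgn \<alpha> * \<beta>) \<longleftrightarrow> n \<le> m"
proof -
  have fin: "finite {i. b i \<noteq> 0}" and dig: "\<And>i. 0 \<le> b i" "\<And>i. b i \<le> a" "\<And>i. b i = a \<Longrightarrow> b (i - 1) = 0"
    and bm: "b m \<noteq> 0" and low: "\<And>i. i < m \<Longrightarrow> b i = 0"
    and \<alpha>: "\<alpha> = digits_value \<theta> b \<or> \<alpha> = - digits_value \<theta> b"
    using exp unfolding greedy_expansion_def greedy_digits_def by auto
  define N where "N = nat (Max {i. b i \<noteq> 0} - m + 1)"
  define c where "c = (\<lambda>k. b (m + int k))"
  have N: "m \<le> i \<and> i < m + int N" if "b i \<noteq> 0" for i
    using Max_ge[OF fin, of i] low[of i] that unfolding N_def by force
  have c: "nat_digits c N"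
    unfolding nat_digits_def c_def
  proof (intro conjI allI impI)
    show "b (m + int k) = 0" if "b (m + int (Suc k)) = a" for k
      using dig(3)[OF that] by (simp add: algebra_simps)
    show "b (m + int k) = 0" if "N \<le> k" for k
      using N[of "m + int k"] that by force
  qed (use dig in auto)
  have val: "digits_value \<theta> b = \<theta> powi m * nat_value \<theta> c N"
    unfolding c_def using N by (rule digits_value_eq_nat_value)
  have c0: "c 0 \<ge> 1" using bm dig(1)[of m] unfolding c_def by simp
  have "N \<noteq> 0" using N[OF bm] by auto
  then have "of_int (c 0) * \<theta> ^ 0 \<le> nat_value \<theta> c N"
    unfolding nat_value_def using c theta_gt_1 unfolding nat_digits_def
    by (intro member_le_sum) auto
  moreover have "real_of_int (c 0) \<ge> 1" using c0 by simp
  ultimately have pos: "digits_value \<theta> b > 0"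
    unfolding val using theta_gt_1 by simp
  have conj': "conjugates (digits_value \<theta> b) (\<omega> powi m * nat_value \<omega> c N)"
    unfolding val by (intro conjugates_mult conjugates_powi conjugates_nat_value)
  have eq: "sgn \<alpha> * \<beta> = \<omega> powi m * nat_value \<omega> c N"
    using \<alpha>
  proof
    assume "\<alpha> = digits_value \<theta> b"
    then show ?thesis
      using conjugates_unique[OF conj] conj' pos by auto
  next
    assume "\<alpha> = - digits_value \<theta> b"
    then show ?thesis
      using conjugates_unique[OF conj] conjugates_minus[OF conj'] pos by auto
  qed
  define S where "S = nat_value \<omega> c N"
  have S: "- \<omega> < S" "-1 < S" "S < \<theta>"
  proof -
    have "real_of_int (c 0) \<le> of_int a" using c unfolding nat_digits_def by simp
    then show "- \<omega> < S" "-1 < S" "S < \<theta>"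
      using nat_value_omega_bounds[OF c] c0 \<open>real_of_int (c 0) \<ge> 1\<close> unfolding S_def
      by (auto simp: \<omega>_def)
  qed
  have at_m: "(- \<theta>) powi m * (sgn \<alpha> * \<beta>) = S"
    unfolding eq S_def using omega_powi_theta_powi[of m] by (simp flip: mult.assoc)
  have "in_window m (sgn \<alpha> * \<beta>)"
    unfolding in_window_def at_m using S by simp
  moreover have "\<not> in_window (m + 1) (sgn \<alpha> * \<beta>)"
  proof -
    have "(- \<theta>) powi (m + 1) * (sgn \<alpha> * \<beta>) = - \<theta> * S"
      using theta_gt_1 at_m by (simp add: power_int_add_1')
    moreover have "\<theta> * (- \<omega>) < \<theta> * S"
      using S theta_gt_1 by (intro mult_strict_left_mono) auto
    ultimately show ?thesis
      unfolding in_window_def using theta_omega by simp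
  qed
  ultimately show ?thesis
    using in_window_antimono[of m _ n] in_window_antimono[of n _ "m + 1"] by force
qed

text \<open>Multiplication by a high power of \<theta> shrinks the conjugate below 1 in absolute
  value, so \<open>nat_digits_exist\<close> applies; the digits are then shifted back.\<close>

lemma greedy_expansion_exists:
  assumes conj: "conjugates \<alpha> \<beta>" and "\<alpha> \<noteq> 0"
  shows "\<exists>m b. greedy_expansion a \<theta> \<alpha> m b"
proof -
  obtain M where M: "\<bar>\<beta>\<bar> < \<theta> ^ M"
    using real_arch_pow[OF theta_gt_1] by blast
  define n where "n = - int M"
  define \<alpha>0 where "\<alpha>0 = \<theta> powi (- n) * (sgn \<alpha> * \<alpha>)"
  define \<beta>0 where "\<beta>0 = \<omega> powi (- n) * (sgn \<alpha> * \<beta>)"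
  have "conjugates (sgn \<alpha>) (sgn \<alpha>)"
    using conjugates_of_int[of 1] conjugates_of_int[of "-1"] conjugates_of_int[of 0]
    by (auto simp: sgn_if)
  then have conj0: "conjugates \<alpha>0 \<beta>0"
    unfolding \<alpha>0_def \<beta>0_def by (intro conjugates_mult conjugates_powi conj)
  have abs_eq: "\<bar>\<alpha>\<bar> = sgn \<alpha> * \<alpha>" by (simp add: abs_sgn mult.commute)
  have pos: "\<alpha>0 > 0"
    unfolding \<alpha>0_def abs_eq[symmetric] using theta_gt_1 assms by simp
  obtain N where N: "\<alpha>0 < \<theta> ^ N"
    using real_arch_pow[OF theta_gt_1] by blast
  have "\<bar>\<beta>0\<bar> = \<bar>\<omega>\<bar> ^ M * \<bar>\<beta>\<bar>"
    unfolding \<beta>0_def n_def using assms by (simp add: abs_mult abs_sgn_eq power_abs)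
  also have "\<dots> < \<bar>\<omega>\<bar> ^ M * \<theta> ^ M"
    using M omega_bounds by (intro mult_strict_left_mono) auto
  also have "\<dots> = 1"
    using theta_omega omega_bounds by (simp add: mult.commute flip: power_mult_distrib)
  finally have "-1 < \<beta>0" "\<beta>0 < \<theta>" using theta_gt_1 by auto
  then obtain c where c: "nat_digits c N" "\<alpha>0 = nat_value \<theta> c N"
    using nat_digits_exist[OF conj0 _ N] pos by auto
  have ex: "\<exists>k. c k \<noteq> 0"
  proof (rule ccontr)
    assume "\<nexists>k. c k \<noteq> 0"
    then show False using pos c(2) by (simp add: nat_value_def)
  qed
  \<comment> \<open>The digits found may start with zeros, so the lowest index is
    \<open>n + int l\<close> and not \<open>n\<close>.\<close>
  define l where "l = (LEAST k. c k \<noteq> 0)"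
  have cl: "c l \<noteq> 0"
    unfolding l_def using ex by (rule LeastI_ex)
  have cl': "c k = 0" if "k < l" for k
    using not_less_Least[OF that[unfolded l_def]] by simp
  define b where "b = (\<lambda>i. if i < n then 0 else c (nat (i - n)))"
  have supp: "n \<le> i \<and> i < n + int N" if "b i \<noteq> 0" for i
  proof -
    have "n \<le> i" "c (nat (i - n)) \<noteq> 0"
      using that unfolding b_def by (auto split: if_splits)
    moreover have "nat (i - n) < N"
    proof (rule ccontr)
      assume "\<not> nat (i - n) < N"
      then have "c (nat (i - n)) = 0" using c(1) unfolding nat_digits_def by simp
      then show False using \<open>c (nat (i - n)) \<noteq> 0\<close> by simp
    qed
    ultimately show ?thesis by linarith
  qed
  have "{i. b i \<noteq> 0} \<subseteq> {n..<n + int N}"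
    using supp by auto
  then have "finite {i. b i \<noteq> 0}"
    by (rule finite_subset) simp
  moreover have "b (i - 1) = 0" if "b i = a" for i
  proof (cases "i - 1 < n")
    case False
    then have "nat (i - n) = Suc (nat (i - 1 - n))" by simp
    then show ?thesis
      using False that c(1) unfolding b_def nat_digits_def by auto
  qed (simp add: b_def)
  moreover have "0 \<le> b i" "b i \<le> a" for i
    using c(1) a_ge_1 unfolding b_def nat_digits_def by auto
  ultimately have greedy: "greedy_digits a b"
    unfolding greedy_digits_def by simp
  have "digits_value \<theta> b = \<theta> powi n * nat_value \<theta> (\<lambda>k. b (n + int k)) N"
    using supp by (rule digits_value_eq_nat_value)
  also have "\<dots> = \<theta> powi n * \<alpha>0"
    unfolding c(2) b_def by simp
  also have "\<dots> = \<bar>\<alpha>\<bar>"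
    unfolding \<alpha>0_def abs_eq using theta_gt_1 by (simp add: power_int_minus)
  finally have "\<alpha> = digits_value \<theta> b \<or> \<alpha> = - digits_value \<theta> b" by linarith
  moreover have "b (n + int l) \<noteq> 0" using cl by (simp add: b_def)
  moreover have "b i = 0" if "i < n + int l" for i
    using that cl'[of "nat (i - n)"] by (simp add: b_def)
  ultimately show ?thesis
    using greedy unfolding greedy_expansion_def by blast
qed

section \<open>The infranorm in terms of conjugates, and the inequality\<close>

lemma infranorm_le_iff:
  assumes "conjugates \<alpha> \<beta>"
  shows "infranorm a \<theta> \<alpha> \<le> \<theta> powi (- n) \<longleftrightarrow> in_window n (sgn \<alpha> * \<beta>)"
proof (cases "\<alpha> = 0")
  case True
  then show ?thesis
    using theta_gt_1 by (simp add: infranorm_def in_window_def)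
next
  case False
  from greedy_expansion_exists[OF assms False] obtain m b where
    exp: "greedy_expansion a \<theta> \<alpha> m b" by blast
  \<comment> \<open>Testing the window at the lowest index of each of two expansions shows that each
    index is at most the other.\<close>
  have "(THE m. \<exists>b. greedy_expansion a \<theta> \<alpha> m b) = m"
  proof (rule the_equality)
    show "m' = m" if "\<exists>b. greedy_expansion a \<theta> \<alpha> m' b" for m'
      using that greedy_expansion_in_window[OF assms] exp by (meson order.antisym order.refl)
  qed (use exp in blast)
  then have "infranorm a \<theta> \<alpha> = \<theta> powi (- m)"
    using False by (simp add: infranorm_def)
  then show ?thesis
    using greedy_expansion_in_window[OF assms exp] theta_gt_1
      power_int_increasing[of "- m" "- n" \<theta>] power_int_strict_increasing[of "- n" "- m" \<theta>]
    by (cases "n \<le> m") auto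
qed

text \<open>This reduces differences to sums.\<close>

lemma infranorm_minus:
  "infranorm a \<theta> (- \<alpha>) = infranorm a \<theta> \<alpha>"
proof -
  have "greedy_expansion a \<theta> (- \<alpha>) = greedy_expansion a \<theta> \<alpha>"
    unfolding greedy_expansion_def by (intro ext) auto
  then show ?thesis by (simp add: infranorm_def)
qed

text \<open>The factor \<open>\<theta>\<^sup>2\<close> allows a window index of
  \<open>n - 2\<close>, so it suffices that the scaled conjugate of the sum, up to sign, lies in
  \<open>\<theta>\<^sup>2\<close> times (-1, \<theta>).\<close>

lemma infranorm_add_le_powi:
  assumes conj: "conjugates \<alpha> \<beta>" "conjugates \<alpha>' \<beta>'"
    and le: "infranorm a \<theta> \<alpha> \<le> \<theta> powi (- n)" "infranorm a \<theta> \<alpha>' \<le> \<theta> powi (- n)"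
  shows "infranorm a \<theta> (\<alpha> + \<alpha>') \<le> \<theta>\<^sup>2 * \<theta> powi (- n)"
proof -
  define u where "u = (- \<theta>) powi n * \<beta>"
  define v where "v = (- \<theta>) powi n * \<beta>'"
  \<comment> \<open>For \<alpha> = 0 the factor \<open>sgn \<alpha>\<close> is 0, and the window
    would not bound \<open>u\<close>.\<close>
  have zero: "\<alpha> = 0 \<Longrightarrow> u = 0" "\<alpha>' = 0 \<Longrightarrow> v = 0"
    using conj conjugates_of_int[of 0] conjugates_unique unfolding u_def v_def by fastforce+
  have u: "-1 < sgn \<alpha> * u" "sgn \<alpha> * u < \<theta>" and v: "-1 < sgn \<alpha>' * v" "sgn \<alpha>' * v < \<theta>"
    using le unfolding infranorm_le_iff[OF conj(1)] infranorm_le_iff[OF conj(2)]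
      in_window_def u_def v_def by (simp_all add: mult_ac)
  define s where "s = sgn (\<alpha> + \<alpha>') * (u + v)"
  have a_theta: "\<theta> \<le> of_int a * \<theta>" using a_ge_1 theta_gt_1 by simp
  then have sq: "\<theta> + 1 \<le> \<theta>\<^sup>2" using theta_eq by simp
  have cube: "\<theta>\<^sup>2 * \<theta> \<ge> 2 * \<theta>"
    using sq theta_gt_1 by (intro mult_right_mono) auto
  \<comment> \<open>Equal signs give a value in (-2, 2\<theta>), opposite signs one of absolute
    value below \<theta> + 1.\<close>
  have "- (\<theta> + 1) < s \<and> s < 2 * \<theta>"
    using u v zero theta_gt_1 unfolding s_def by (auto simp: sgn_if split: if_splits)
  then have s: "-1 * \<theta>\<^sup>2 < s" "s < \<theta> * \<theta>\<^sup>2"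
    using sq cube by (simp_all add: mult.commute)
  have "(- \<theta>) powi (n - 2) * (sgn (\<alpha> + \<alpha>') * (\<beta> + \<beta>')) = s / \<theta>\<^sup>2"
    using theta_gt_1 by (simp add: power_int_diff s_def u_def v_def field_simps)
  moreover have "-1 < s / \<theta>\<^sup>2" "s / \<theta>\<^sup>2 < \<theta>"
    using s theta_gt_1 by (simp_all add: less_divide_eq divide_less_eq)
  ultimately have "in_window (n - 2) (sgn (\<alpha> + \<alpha>') * (\<beta> + \<beta>'))"
    unfolding in_window_def by simp
  then have "infranorm a \<theta> (\<alpha> + \<alpha>') \<le> \<theta> powi (- (n - 2))"
    unfolding infranorm_le_iff[OF conjugates_add[OF conj]] .
  also have "\<theta> powi (- (n - 2)) = \<theta>\<^sup>2 * \<theta> powi (- n)"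
    using theta_gt_1 by (simp add: power_int_diff power_int_minus field_simps)
  finally show ?thesis .
qed

lemma infranorm_add_le:
  assumes "conjugates \<alpha> \<beta>" "conjugates \<alpha>' \<beta>'"
  shows "infranorm a \<theta> (\<alpha> + \<alpha>') \<le> \<theta>\<^sup>2 * max (infranorm a \<theta> \<alpha>) (infranorm a \<theta> \<alpha>')"
proof -
  define M where "M = max (infranorm a \<theta> \<alpha>) (infranorm a \<theta> \<alpha>')"
  have inf_cases: "x = 0 \<or> (\<exists>n. infranorm a \<theta> x = \<theta> powi (- n))" for x
    unfolding infranorm_def by auto
  have nonneg: "infranorm a \<theta> x \<ge> 0" for x
    using theta_gt_1 by (simp add: infranorm_def)
  \<comment> \<open>The preceding lemma needs a power of \<theta> as bound, and the maximum is one
    unless both elements are 0.\<close>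
  consider "\<alpha> = 0" "\<alpha>' = 0" | n where "M = \<theta> powi (- n)"
  proof -
    have "M = infranorm a \<theta> \<alpha> \<or> M = infranorm a \<theta> \<alpha>'"
      unfolding M_def by linarith
    moreover have "infranorm a \<theta> 0 = 0" by (simp add: infranorm_def)
    ultimately show thesis
      using that inf_cases[of \<alpha>] inf_cases[of \<alpha>'] nonneg[of \<alpha>] nonneg[of \<alpha>'] unfolding M_def
      by (smt (verit))
  qed
  then show ?thesis
  proof cases
    case 1
    then show ?thesis by (simp add: infranorm_def)
  next
    case 2
    then show ?thesis
      using infranorm_add_le_powi[OF assms, of n] unfolding M_def by (metis max.cobounded1 max.cobounded2)
  qed
qed

end

theorem theorem4:
  fixes \<theta> :: real and a :: int and f g :: real
  assumes "\<theta> > 1" and "a \<ge> 1" and "\<theta>\<^sup>2 = of_int a * \<theta> + 1"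
    and "f \<in> ring_of_integers (Q_adjoin \<theta>)" and "g \<in> ring_of_integers (Q_adjoin \<theta>)"
    and "f \<in> Z_adjoin \<theta>" and "g \<in> Z_adjoin \<theta>"
  shows "infranorm a \<theta> (f + g) \<le> \<theta>\<^sup>2 * max (infranorm a \<theta> f) (infranorm a \<theta> g) \<and>
         infranorm a \<theta> (f - g) \<le> \<theta>\<^sup>2 * max (infranorm a \<theta> f) (infranorm a \<theta> g)"
proof -
  interpret quadratic_unit \<theta> a
    using assms(1-3) by unfold_locales
  obtain \<beta> \<beta>' where conj: "conjugates f \<beta>" "conjugates g \<beta>'"
    using assms(6,7) Z_adjoin_conjugates by metis
  show ?thesis
    using infranorm_add_le[OF conj] infranorm_add_le[OF conj(1) conjugates_minus[OF conj(2)]]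
    by (simp add: infranorm_minus)
qed

end
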